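(* Let $N\ge 3$ and $k\ge 1$ be integers. If there exists a simple avoidance coupling of $k$ walks on the complete graph $K_{N-1}$, then there exists a simple avoidance coupling of $k$ walks on the complete graph $K_{N}$.
   Context: For a positive integer $n$ write $[n]=\{1,\dots,n\}$. $K_n$ denotes the complete graph (without loops) on vertex set $[n]$. A simple random walk on a graph $G$ with vertex set $[n]$ is a Markov chain $(X_t)_{t\in\mathbb{Z}}$ (indexed by all integers) of elements of $[n]$ such that for all $t\in\mathbb{Z}$, given the past, $X_t$ is uniformly distributed on the neighbors of $X_{t-1}$. Explicitly: for every $t\in\mathbb{Z}$, every $\ell\ge 1$, every history $w_{t-\ell},\dots,w_{t-1}\in[n]$ with $\mathbb{P}(X_{t-1}=w_{t-1},\dots,X_{t-\ell}=w_{t-\ell})>0$ and every neighbor $v$ of $w_{t-1}$, $$\mathbb{P}(X_t=v\mid X_{t-1}=w_{t-1},\dots,X_{t-\ell}=w_{t-\ell})=\frac{1}{\deg(w_{t-1})}.$$ (On $K_n$, this means conditional probability $\frac1{n-1}$ for every $v\ne w_{t-1}$.) A simple avoidance coupling (SAC) of $k$ walks on a graph $G$ with vertex set $[n]$ is a sequence $(U_t)_{t\in\mathbb{Z}}$ of random maps $U_t:[k]\to[n]$, all defined on a common probability space, such that: (1) for every $i\in[k]$, $(U_t(i))_{t\in\mathbb{Z}}$ is a simple random walk on $G$; (2) for every $t\in\mathbb{Z}$ and all $1\le i<j\le k$, $\mathbb{P}(U_t(i)=U_t(j))=\mathbb{P}(U_t(i)=U_{t-1}(j))=0$. (No independence between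 different walks is required. The walkers take turns in the order $1,\dots,k$ in each round.) The existence of a SAC means that some probability space carries such a sequence. *)

theory Defs
  imports "HOL-Probability.Probability" "Graph_Theory.Pair_Digraph" "Graph_Theory.Kuratowski"
begin

definition complete_graph_on :: "nat \<Rightarrow> nat pair_pre_digraph" where
  "complete_graph_on n =
     \<lparr> pverts = {1..n}, parcs = {(u, v). u \<in> {1..n} \<and> v \<in> {1..n} \<and> u \<noteq> v} \<rparr>"

text \<open>
  The history of length \<open>l\<close> before time \<open>t\<close> is given by \<open>w\<close>, where only the
  values \<open>w s\<close> with \<open>t - l \<le> s \<le> t - 1\<close> matter.  Undirected graphs are symmetric digraphs,
  so the neighbours of \<open>u\<close> are the \<open>v\<close> with \<open>(u, v) \<in> parcs G\<close> and the degree is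
  \<^const>\<open>out_degree\<close>.
\<close>

definition simple_random_walk ::
    "'a measure \<Rightarrow> 'v pair_pre_digraph \<Rightarrow> (int \<Rightarrow> 'a \<Rightarrow> 'v) \<Rightarrow> bool" where
  "simple_random_walk M G X \<longleftrightarrow>
     prob_space M \<and>
     (\<forall>t. X t \<in> measurable M (count_space (pverts G))) \<and>
     (\<forall>t. \<forall>l::nat. \<forall>w v.
        l \<ge> 1 \<longrightarrow>
        (\<forall>s\<in>{t - int l..t - 1}. w s \<in> pverts G) \<longrightarrow>
        \<P>(\<omega> in M. \<forall>s\<in>{t - int l..t - 1}. X s \<omega> = w s) > 0 \<longrightarrow>
        (w (t - 1), v) \<in> parcs G \<longrightarrow>
        \<P>(\<omega> in M. X t \<omega> = v \<bar> \<forall>s\<in>{t - int l..t - 1}. X s \<omega> = w s)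
          = 1 / real (out_degree (with_proj G) (w (t - 1))))"

text \<open>
  Here \<open>U t \<omega>\<close> is the map \<open>U\<^sub>t\<close> at the outcome \<open>\<omega>\<close>.  The maps
  from \<open>{1..k}\<close> to the vertices are represented by the extensional function space, which is
  finite when the graph is.

  Existence of a coupling means existence over some probability space of arbitrary outcome type.
  All conditions depend only on the joint law of the \<open>U\<^sub>t\<close>, so for vertices in \<^typ>\<open>nat\<close> one may
  always take \<^typ>\<open>int \<Rightarrow> nat \<Rightarrow> nat\<close> (trajectories) as the outcome type.
\<close>

definition simple_avoidance_coupling ::
    "'a measure \<Rightarrow> nat \<Rightarrow> 'v pair_pre_digraph \<Rightarrow> (int \<Rightarrow> 'a \<Rightarrow> nat \<Rightarrow> 'v) \<Rightarrow> bool" where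
  "simple_avoidance_coupling M k G U \<longleftrightarrow>
     prob_space M \<and>
     (\<forall>t. U t \<in> measurable M (count_space ({1..k} \<rightarrow>\<^sub>E pverts G))) \<and>
     (\<forall>i\<in>{1..k}. simple_random_walk M G (\<lambda>t \<omega>. U t \<omega> i)) \<and>
     (\<forall>t. \<forall>i\<in>{1..k}. \<forall>j\<in>{1..k}. i < j \<longrightarrow>
        \<P>(\<omega> in M. U t \<omega> i = U t \<omega> j) = 0 \<and>
        \<P>(\<omega> in M. U t \<omega> i = U (t - 1) \<omega> j) = 0)"

lemma complete_digraph_complete_graph_on: "K\<^bsub>n\<^esub> (with_proj (complete_graph_on n))"
  unfolding complete_digraph_pair_def by (auto simp: complete_graph_on_def)

lemma out_degree_complete_graph_on:
  assumes "u \<in> {1..n}"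
  shows "out_degree (with_proj (complete_graph_on n)) u = n - 1"
proof -
  have "out_arcs (with_proj (complete_graph_on n)) u = Pair u ` ({1..n} - {u})"
    using assms by (auto simp: complete_graph_on_def out_arcs_def)
  then show ?thesis
    using assms by (simp add: out_degree_def card_image inj_on_def)
qed

end

theory Submission
  imports Defs "HOL-Combinatorics.Permutations"
begin

text \<open>
  The coupling on \<open>K\<^sub>N\<close> is obtained from the one on \<open>K\<^sub>N\<^sub>-\<^sub>1\<close> by relabelling the vertices with an
  independent, randomly evolving permutation.  Let \<open>U\<close> be the given coupling, and let
  \<open>(\<sigma>\<^sub>t)\<close> be a process of permutations of \<open>{1..N}\<close>, independent of \<open>U\<close>, with
  \<open>\<sigma>\<^sub>t = \<sigma>\<^sub>t\<^sub>-\<^sub>1 \<circ> (b\<^sub>t N)\<close> for independent uniform labels \<open>b\<^sub>t \<in> {1..N - 1}\<close>.  Put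
  \<open>V\<^sub>t(i) = \<sigma>\<^sub>t(U\<^sub>t(i))\<close>.  After round \<open>t\<close> the vertex \<open>\<sigma>\<^sub>t(N)\<close> is a hole that nobody occupies.  In
  the passage from round \<open>t - 1\<close> to round \<open>t\<close> the label \<open>b\<^sub>t\<close> moves to the hole, and the vertex that
  it leaves becomes the new hole.

  Avoidance survives whatever the labels \<open>b\<^sub>t\<close> are.  Distinct labels have distinct vertices, so
  walkers with distinct \<open>U\<^sub>t\<close> have distinct \<open>V\<^sub>t\<close>.  If the labels \<open>x = U\<^sub>t(i)\<close> and
  \<open>y = U\<^sub>t\<^sub>-\<^sub>1(j)\<close> differ, then the new vertex of \<open>x\<close> is either its old vertex or the old hole,
  and neither of these is the old vertex of \<open>y\<close> (lemma \<open>relabelled_positions_distinct\<close>).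

  Each \<open>V(i)\<close> is a simple random walk.  Given the past, a walker at label \<open>x\<close> moves to a uniform
  label \<open>y \<noteq> x\<close> in \<open>{1..N - 1}\<close>.  With probability \<open>1/(N-1)\<close> it happens that \<open>b\<^sub>t = y\<close>, and the
  walker enters the hole; otherwise it arrives at the old vertex of \<open>y\<close>, so each of these
  \<open>N - 2\<close> vertices has probability \<open>((N-2)/(N-1)) / (N-2) = 1/(N-1)\<close> as well.  In terms of graphs:
  \<open>(U(i), \<sigma>)\<close> is a simple random walk on the tensor product of \<open>K\<^sub>N\<^sub>-\<^sub>1\<close> with a Cayley graph of the
  symmetric group (lemma \<open>simple_random_walk_tensor_product\<close>), the evaluation map
  \<open>(x, p) \<mapsto> p(x)\<close> from this product to \<open>K\<^sub>N\<close> has equally many lifts of every arc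
  (lemma \<open>card_lifts_evaluation\<close>), and such maps carry simple random walks to simple random walks
  (lemma \<open>simple_random_walk_image\<close>).

  Time runs over all integers, so \<open>\<sigma>\<close> has no first step.  It is anchored at time 0 at a uniformly
  distributed permutation and continued in both directions by independent uniform increments;
  invariance of the uniform distribution makes \<open>\<sigma>\<^sub>t\<close> independent of the whole sequence of
  increments for every \<open>t\<close> (lemma \<open>exists_simple_random_walk_cayley_graph\<close>).
\<close>

section \<open>Maps into countable discrete spaces and finite digraphs\<close>

lemma out_degree_with_proj: "out_degree (with_proj G) u = card {v. (u, v) \<in> parcs G}"
proof -
  have "out_arcs (with_proj G) u = Pair u ` {v. (u, v) \<in> parcs G}"
    by (auto simp: out_arcs_def)
  then show ?thesis
    by (simp add: out_degree_def card_image inj_on_def)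
qed

lemma (in pair_wf_digraph) pair_arc_in_verts:
  assumes "(u, v) \<in> parcs G"
  shows "u \<in> pverts G" "v \<in> pverts G"
  using arc_fst_in_verts[OF assms] arc_snd_in_verts[OF assms] by simp_all

lemma sets_Collect_count_space:
  assumes "f \<in> measurable M (count_space A)"
  shows "{x \<in> space M. P (f x)} \<in> sets M"
proof -
  have "{x \<in> space M. P (f x)} = f -` {a \<in> A. P a} \<inter> space M"
    using measurable_space[OF assms] by auto
  then show ?thesis
    using measurable_sets[OF assms, of "{a \<in> A. P a}"] by simp
qed

lemma measurable_count_space_Pair:
  assumes "f \<in> measurable M (count_space A)" "g \<in> measurable M (count_space B)"
    and "countable A" "countable B"
  shows "(\<lambda>x. (f x, g x)) \<in> measurable M (count_space (A \<times> B))"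
  using measurable_Pair[OF assms(1,2)] assms(3,4) by (simp add: pair_measure_countable)

lemma measurable_count_space_comp:
  assumes "f \<in> measurable M (count_space A)" and "\<And>a. a \<in> A \<Longrightarrow> h a \<in> B"
  shows "(\<lambda>x. h (f x)) \<in> measurable M (count_space B)"
  using measurable_compose[OF assms(1), of h "count_space B"] assms(2) by auto

lemma measurable_count_space_comp2:
  assumes "f \<in> measurable M (count_space A)" "g \<in> measurable M (count_space B)"
    and "countable A" "countable B" and "\<And>a b. a \<in> A \<Longrightarrow> b \<in> B \<Longrightarrow> h a b \<in> C"
  shows "(\<lambda>x. h (f x) (g x)) \<in> measurable M (count_space C)"
  using measurable_count_space_comp[OF measurable_count_space_Pair[OF assms(1-4)], of "case_prod h" C]
    assms(5) by auto

section \<open>Simple random walks through joint probabilities\<close>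

definition history ::
    "'a measure \<Rightarrow> (int \<Rightarrow> 'a \<Rightarrow> 'v) \<Rightarrow> int \<Rightarrow> nat \<Rightarrow> (int \<Rightarrow> 'v) \<Rightarrow> 'a set" where
  "history M X t l w = {\<omega> \<in> space M. \<forall>s\<in>{t - int l..t - 1}. X s \<omega> = w s}"

lemma history_in_sets:
  assumes "\<And>t. X t \<in> measurable M (count_space V)"
  shows "history M X t l w \<in> sets M"
  unfolding history_def
  by (intro sets.sets_Collect_finite_All sets_Collect_count_space[OF assms]) auto

text \<open>
  Unlike conditional probabilities, joint probabilities can be summed over histories and need no
  case distinction for null events.  In terms of them the transition rule says that every arc out of
  the last vertex receives an equal share of the probability of the history.
\<close>

lemma simple_random_walkI:
  assumes "prob_space M" "\<And>t. X t \<in> measurable M (count_space (pverts G))"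
    and step: "\<And>t l w v. l \<ge> 1 \<Longrightarrow> (\<forall>s\<in>{t - int l..t - 1}. w s \<in> pverts G) \<Longrightarrow>
      (w (t - 1), v) \<in> parcs G \<Longrightarrow>
      measure M (history M X t l w \<inter> {\<omega> \<in> space M. X t \<omega> = v})
        = measure M (history M X t l w) / real (out_degree (with_proj G) (w (t - 1)))"
  shows "simple_random_walk M G X"
  unfolding simple_random_walk_def cond_prob_def
proof (intro conjI allI impI)
  fix t :: int and l :: nat and w v
  assume l: "1 \<le> l" and w: "\<forall>s\<in>{t - int l..t - 1}. w s \<in> pverts G"
    and pos: "0 < \<P>(\<omega> in M. \<forall>s\<in>{t - int l..t - 1}. X s \<omega> = w s)"
    and v: "(w (t - 1), v) \<in> parcs G"
  have "{\<omega> \<in> space M. X t \<omega> = v \<and> (\<forall>s\<in>{t - int l..t - 1}. X s \<omega> = w s)}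
    = history M X t l w \<inter> {\<omega> \<in> space M. X t \<omega> = v}"
    by (auto simp: history_def)
  then show "\<P>(\<omega> in M. X t \<omega> = v \<and> (\<forall>s\<in>{t - int l..t - 1}. X s \<omega> = w s)) /
      \<P>(\<omega> in M. \<forall>s\<in>{t - int l..t - 1}. X s \<omega> = w s)
      = 1 / real (out_degree (with_proj G) (w (t - 1)))"
    using step[OF l w v] pos by (simp add: history_def)
qed (use assms(1,2) in auto)

text \<open>
  The definition speaks of moves along arcs only.  Moves that are not along arcs have probability
  zero because the shares of the outgoing arcs already exhaust the probability of the history; this
  fails at a vertex without outgoing arcs, whence the assumption on the degree.
\<close>

lemma simple_random_walk_prob_step:
  assumes "simple_random_walk M G X" and "pair_fin_digraph G"
    and l: "l \<ge> 1" and w: "\<forall>s\<in>{t - int l..t - 1}. w s \<in> pverts G"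
    and deg: "out_degree (with_proj G) (w (t - 1)) > 0"
  shows "measure M (history M X t l w \<inter> {\<omega> \<in> space M. X t \<omega> = v})
    = (if (w (t - 1), v) \<in> parcs G
       then measure M (history M X t l w) / real (out_degree (with_proj G) (w (t - 1))) else 0)"
proof -
  interpret prob_space M using assms(1) by (simp add: simple_random_walk_def)
  interpret G: pair_fin_digraph G by fact
  let ?H = "history M X t l w" and ?d = "out_degree (with_proj G) (w (t - 1))"
  let ?N = "{v. (w (t - 1), v) \<in> parcs G}" and ?E = "\<lambda>v. {\<omega> \<in> space M. X t \<omega> = v}"
  have X: "X s \<in> measurable M (count_space (pverts G))" for s
    using assms(1) by (simp add: simple_random_walk_def)
  have H: "?H \<in> sets M" using X by (rule history_in_sets)
  have E: "?E v \<in> sets M" for v by (rule sets_Collect_count_space[OF X])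
  have arc: "prob (?H \<inter> ?E v) = prob ?H / ?d" if v: "v \<in> ?N" for v
  proof (cases "prob ?H > 0")
    case True
    have eq: "{\<omega> \<in> space M. X t \<omega> = v \<and> (\<forall>s\<in>{t - int l..t - 1}. X s \<omega> = w s)} = ?H \<inter> ?E v"
      by (auto simp: history_def)
    have "\<P>(\<omega> in M. X t \<omega> = v \<bar> \<forall>s\<in>{t - int l..t - 1}. X s \<omega> = w s) = 1 / ?d"
      using assms(1) l w v True unfolding simple_random_walk_def history_def by blast
    then have "prob (?H \<inter> ?E v) / prob ?H = 1 / ?d"
      unfolding cond_prob_def eq by (simp add: history_def)
    then show ?thesis using True by (simp add: field_simps)
  next
    case False
    then have "prob ?H = 0" using measure_nonneg[of M ?H] by linarith
    moreover have "prob (?H \<inter> ?E v) \<le> prob ?H" using H by (intro finite_measure_mono) auto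
    ultimately show ?thesis using measure_nonneg[of M "?H \<inter> ?E v"] by simp
  qed
  show ?thesis
  proof (cases "v \<in> ?N")
    case True
    then show ?thesis using arc by simp
  next
    case False
    have fin: "finite ?N"
      by (rule finite_subset[OF _ G.pair_finite_verts]) (auto dest: G.pair_arc_in_verts)
    have "(\<Sum>u\<in>insert v ?N. prob (?H \<inter> ?E u)) = prob (\<Union>u\<in>insert v ?N. ?H \<inter> ?E u)"
      using fin H E by (intro finite_measure_finite_Union[symmetric])
        (auto simp: disjoint_family_on_def)
    also have "\<dots> \<le> prob ?H" using H by (intro finite_measure_mono) auto
    finally have "prob (?H \<inter> ?E v) + (\<Sum>u\<in>?N. prob (?H \<inter> ?E u)) \<le> prob ?H"
      using fin False by simp
    moreover have "(\<Sum>u\<in>?N. prob (?H \<inter> ?E u)) = prob ?H"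
      using deg by (simp add: arc out_degree_with_proj)
    ultimately have "prob (?H \<inter> ?E v) \<le> 0"
      by simp
    then show ?thesis using False measure_nonneg[of M "?H \<inter> ?E v"] by simp
  qed
qed

lemma simple_random_walk_AE_arc:
  assumes srw: "simple_random_walk M G X" and "pair_fin_digraph G"
    and deg: "\<And>u. u \<in> pverts G \<Longrightarrow> out_degree (with_proj G) u > 0"
  shows "AE \<omega> in M. (X (t - 1) \<omega>, X t \<omega>) \<in> parcs G"
proof -
  interpret prob_space M using assms(1) by (simp add: simple_random_walk_def)
  interpret G: pair_fin_digraph G by fact
  have X: "X s \<in> measurable M (count_space (pverts G))" for s
    using assms(1) by (simp add: simple_random_walk_def)
  have "AE \<omega> in M. \<forall>e\<in>pverts G \<times> pverts G - parcs G. \<not> (X (t - 1) \<omega> = fst e \<and> X t \<omega> = snd e)"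
  proof (rule AE_finite_allI)
    show "finite (pverts G \<times> pverts G - parcs G)" using G.pair_finite_verts by simp
    fix e assume e: "e \<in> pverts G \<times> pverts G - parcs G"
    have "{\<omega> \<in> space M. X (t - 1) \<omega> = fst e \<and> X t \<omega> = snd e}
      = history M X t 1 (\<lambda>_. fst e) \<inter> {\<omega> \<in> space M. X t \<omega> = snd e}"
      by (auto simp: history_def)
    moreover have "prob \<dots> = 0"
      using e simple_random_walk_prob_step[OF assms(1,2), of 1 t "\<lambda>_. fst e" "snd e"] deg by auto
    moreover have "history M X t 1 (\<lambda>_. fst e) \<inter> {\<omega> \<in> space M. X t \<omega> = snd e} \<in> sets M"
      by (intro sets.Int history_in_sets[OF X] sets_Collect_count_space[OF X])
    ultimately have "AE \<omega> in M. \<omega> \<notin> {\<omega> \<in> space M. X (t - 1) \<omega> = fst e \<and> X t \<omega> = snd e}"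
      by (simp add: prob_eq_0)
    then show "AE \<omega> in M. \<not> (X (t - 1) \<omega> = fst e \<and> X t \<omega> = snd e)"
      by (rule AE_mp) (intro AE_I2, auto)
  qed
  then show ?thesis
  proof (rule AE_mp, intro AE_I2 impI)
    fix \<omega> assume "\<omega> \<in> space M"
      and no: "\<forall>e\<in>pverts G \<times> pverts G - parcs G. \<not> (X (t - 1) \<omega> = fst e \<and> X t \<omega> = snd e)"
    then have "(X (t - 1) \<omega>, X t \<omega>) \<in> pverts G \<times> pverts G"
      using measurable_space[OF X] by fastforce
    then show "(X (t - 1) \<omega>, X t \<omega>) \<in> parcs G" using no by (metis DiffI fst_conv snd_conv)
  qed
qed

lemma simple_random_walk_distr:
  assumes \<phi>: "\<phi> \<in> measurable M M'" and Y: "\<And>t. Y t \<in> measurable M' (count_space (pverts G))"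
    and srw: "simple_random_walk M G (\<lambda>t \<omega>. Y t (\<phi> \<omega>))"
  shows "simple_random_walk (distr M M' \<phi>) G Y"
proof -
  interpret prob_space M using srw by (simp add: simple_random_walk_def)
  have prob: "\<P>(x in distr M M' \<phi>. P x) = \<P>(\<omega> in M. P (\<phi> \<omega>))"
    if "{x \<in> space M'. P x} \<in> sets M'" for P
    using measure_distr[OF \<phi> that] measurable_space[OF \<phi>]
    by (auto intro!: arg_cong[where f = "measure M"])
  have win: "{x \<in> space M'. \<forall>s\<in>{t - int l..t - 1}. Y s x = w s} \<in> sets M'" for t l w
    using history_in_sets[OF Y] by (simp add: history_def)
  have joint: "{x \<in> space M'. Y t x = v \<and> (\<forall>s\<in>{t - int l..t - 1}. Y s x = w s)} \<in> sets M'" for t l w v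
    by (intro sets.sets_Collect_conj win sets_Collect_count_space[OF Y])
  have "\<P>(x in distr M M' \<phi>. Y t x = v \<bar> \<forall>s\<in>{t - int l..t - 1}. Y s x = w s)
      = \<P>(\<omega> in M. Y t (\<phi> \<omega>) = v \<bar> \<forall>s\<in>{t - int l..t - 1}. Y s (\<phi> \<omega>) = w s)" for t l w v
    unfolding cond_prob_def by (intro arg_cong2[where f = "(/)"] prob win joint)
  moreover have "\<P>(x in distr M M' \<phi>. \<forall>s\<in>{t - int l..t - 1}. Y s x = w s)
      = \<P>(\<omega> in M. \<forall>s\<in>{t - int l..t - 1}. Y s (\<phi> \<omega>) = w s)" for t l w
    by (intro prob win)
  ultimately show ?thesis
    using srw Y prob_space_distr[OF \<phi>]
    unfolding simple_random_walk_def measurable_distr_eq1 by presburger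
qed

section \<open>Products and images of random walks\<close>

definition tensor_product :: "'v pair_pre_digraph \<Rightarrow> 'w pair_pre_digraph \<Rightarrow> ('v \<times> 'w) pair_pre_digraph" where
  "tensor_product G H =
     \<lparr> pverts = pverts G \<times> pverts H,
       parcs = {((a, b), (c, d)). (a, c) \<in> parcs G \<and> (b, d) \<in> parcs H} \<rparr>"

lemma pair_fin_digraph_tensor_product:
  assumes "pair_fin_digraph G" "pair_fin_digraph H"
  shows "pair_fin_digraph (tensor_product G H)"
proof -
  interpret G: pair_fin_digraph G by fact
  interpret H: pair_fin_digraph H by fact
  have "parcs (tensor_product G H) \<subseteq> (\<lambda>((a, c), (b, d)). ((a, b), (c, d))) ` (parcs G \<times> parcs H)"
    by (force simp: tensor_product_def)
  then have "finite (parcs (tensor_product G H))"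
    by (rule finite_subset) (intro finite_imageI finite_cartesian_product G.pair_finite_arcs H.pair_finite_arcs)
  then show ?thesis
    by unfold_locales
      (auto simp: tensor_product_def G.pair_finite_verts H.pair_finite_verts
        dest: G.pair_arc_in_verts H.pair_arc_in_verts)
qed

lemma out_degree_tensor_product:
  "out_degree (with_proj (tensor_product G H)) (a, b)
    = out_degree (with_proj G) a * out_degree (with_proj H) b"
proof -
  have "{v. ((a, b), v) \<in> parcs (tensor_product G H)}
      = {c. (a, c) \<in> parcs G} \<times> {d. (b, d) \<in> parcs H}"
    by (auto simp: tensor_product_def)
  then show ?thesis by (simp add: out_degree_with_proj card_cartesian_product)
qed

lemma simple_random_walk_tensor_product:
  assumes X: "simple_random_walk M G X" and Y: "simple_random_walk Q H Y"
    and G: "pair_fin_digraph G" and H: "pair_fin_digraph H"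
  shows "simple_random_walk (M \<Otimes>\<^sub>M Q) (tensor_product G H) (\<lambda>t (\<omega>, q). (X t \<omega>, Y t q))"
proof -
  interpret M: prob_space M using X by (simp add: simple_random_walk_def)
  interpret Q: prob_space Q using Y by (simp add: simple_random_walk_def)
  interpret MQ: pair_prob_space M Q ..
  interpret G: pair_fin_digraph G by fact
  interpret H: pair_fin_digraph H by fact
  let ?Z = "\<lambda>t (\<omega>, q). (X t \<omega>, Y t q)"
  have mX: "X t \<in> measurable M (count_space (pverts G))" for t
    using X by (simp add: simple_random_walk_def)
  have mY: "Y t \<in> measurable Q (count_space (pverts H))" for t
    using Y by (simp add: simple_random_walk_def)
  have times: "measure (M \<Otimes>\<^sub>M Q) (A \<times> B) = measure M A * measure Q B"
    if "A \<in> sets M" "B \<in> sets Q" for A B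
    using Q.emeasure_pair_measure_Times[OF that] by (simp add: measure_def enn2real_mult)
  show ?thesis
  proof (rule simple_random_walkI)
    show "prob_space (M \<Otimes>\<^sub>M Q)" by (rule MQ.prob_space_axioms)
    show "?Z t \<in> measurable (M \<Otimes>\<^sub>M Q) (count_space (pverts (tensor_product G H)))" for t
      using measurable_count_space_Pair[OF measurable_compose[OF measurable_fst mX, of t]
          measurable_compose[OF measurable_snd mY, of t],
          OF countable_finite[OF G.pair_finite_verts] countable_finite[OF H.pair_finite_verts]]
      by (simp add: tensor_product_def case_prod_beta)
    fix t l w v
    assume l: "1 \<le> l" and w: "\<forall>s\<in>{t - int l..t - 1}. w s \<in> pverts (tensor_product G H)"
      and v: "(w (t - 1), v) \<in> parcs (tensor_product G H)"
    let ?HX = "history M X t l (\<lambda>s. fst (w s))" and ?HY = "history Q Y t l (\<lambda>s. snd (w s))"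
    let ?EX = "{\<omega> \<in> space M. X t \<omega> = fst v}" and ?EY = "{q \<in> space Q. Y t q = snd v}"
    have arcs: "(fst (w (t - 1)), fst v) \<in> parcs G" "(snd (w (t - 1)), snd v) \<in> parcs H"
      using v by (auto simp: tensor_product_def)
    have wX: "\<forall>s\<in>{t - int l..t - 1}. (fst (w s)) \<in> pverts G"
      and wY: "\<forall>s\<in>{t - int l..t - 1}. (snd (w s)) \<in> pverts H"
      using w by (auto simp: tensor_product_def)
    have hist: "history (M \<Otimes>\<^sub>M Q) ?Z t l w = ?HX \<times> ?HY"
      by (auto simp: history_def space_pair_measure prod_eq_iff)
    have "history (M \<Otimes>\<^sub>M Q) ?Z t l w \<inter> {z \<in> space (M \<Otimes>\<^sub>M Q). ?Z t z = v}
        = (?HX \<inter> ?EX) \<times> (?HY \<inter> ?EY)"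
      by (auto simp: history_def space_pair_measure prod_eq_iff)
    moreover have sets: "?HX \<in> sets M" "?HY \<in> sets Q" "?EX \<in> sets M" "?EY \<in> sets Q"
      by (intro history_in_sets[of X, OF mX] history_in_sets[of Y, OF mY]
        sets_Collect_count_space[OF mX] sets_Collect_count_space[OF mY])+
    moreover have deg: "out_degree (with_proj G) ((fst (w (t - 1)))) > 0"
      "out_degree (with_proj H) ((snd (w (t - 1)))) > 0"
      using arcs G.pair_finite_arcs H.pair_finite_arcs
      by (auto simp: out_degree_def out_arcs_def card_gt_0_iff)
    ultimately show "measure (M \<Otimes>\<^sub>M Q)
          (history (M \<Otimes>\<^sub>M Q) ?Z t l w \<inter> {z \<in> space (M \<Otimes>\<^sub>M Q). ?Z t z = v})
        = measure (M \<Otimes>\<^sub>M Q) (history (M \<Otimes>\<^sub>M Q) ?Z t l w)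
          / real (out_degree (with_proj (tensor_product G H)) (w (t - 1)))"
      using simple_random_walk_prob_step[OF X G l wX deg(1), of "fst v"]
        simple_random_walk_prob_step[OF Y H l wY deg(2), of "snd v"] arcs
        out_degree_tensor_product[of G H "fst (w (t - 1))" "snd (w (t - 1))"]
      by (simp add: hist times)
  qed
qed

text \<open>
  If the number of ways to lift an arc at \<open>f z\<close> to an arc at \<open>z\<close> depends only on \<open>z\<close>, then a
  uniform step from \<open>z\<close> projects to a uniform step from \<open>f z\<close>, whatever the lift \<open>z\<close> of the present
  position and its past are.  The proof sums over all lifts of a history.
\<close>

lemma simple_random_walk_image:
  assumes Z: "simple_random_walk M G Z" and G: "pair_fin_digraph G"
    and deg: "\<And>z. z \<in> pverts G \<Longrightarrow> out_degree (with_proj G) z > 0"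
    and f: "\<And>z. z \<in> pverts G \<Longrightarrow> f z \<in> pverts H"
    and equitable: "\<And>z v. z \<in> pverts G \<Longrightarrow> (f z, v) \<in> parcs H \<Longrightarrow>
      card {z'. (z, z') \<in> parcs G \<and> f z' = v} * out_degree (with_proj H) (f z)
        = out_degree (with_proj G) z"
  shows "simple_random_walk M H (\<lambda>t \<omega>. f (Z t \<omega>))"
proof (rule simple_random_walkI)
  show "prob_space M" using Z by (simp add: simple_random_walk_def)
  interpret prob_space M by fact
  interpret G: pair_fin_digraph G by fact
  have mZ: "Z t \<in> measurable M (count_space (pverts G))" for t
    using Z by (simp add: simple_random_walk_def)
  show "(\<lambda>\<omega>. f (Z t \<omega>)) \<in> measurable M (count_space (pverts H))" for t
    by (rule measurable_count_space_comp[OF mZ f])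
  fix t :: int and l :: nat and w v
  assume l: "1 \<le> l" and v: "(w (t - 1), v) \<in> parcs H"
  let ?W = "{t - int l..t - 1}"
  let ?H = "history M (\<lambda>t \<omega>. f (Z t \<omega>)) t l w"
  let ?E = "{\<omega> \<in> space M. f (Z t \<omega>) = v}"
  define lifts where "lifts = (\<Pi>\<^sub>E s\<in>?W. {z \<in> pverts G. f z = w s})"
  have fin: "finite lifts"
    unfolding lifts_def using G.pair_finite_verts by (intro finite_PiE) auto
  have HZ: "history M Z t l x \<in> sets M" for x by (rule history_in_sets[OF mZ])
  have EZ: "{\<omega> \<in> space M. P (Z t \<omega>)} \<in> sets M" for P by (rule sets_Collect_count_space[OF mZ])
  have split: "prob (?H \<inter> C) = (\<Sum>x\<in>lifts. prob (history M Z t l x \<inter> C))" if "C \<in> sets M" for C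
  proof -
    have union: "?H \<inter> C = (\<Union>x\<in>lifts. history M Z t l x \<inter> C)"
    proof (intro equalityI subsetI)
      fix \<omega> assume \<omega>: "\<omega> \<in> ?H \<inter> C"
      then have "restrict (\<lambda>s. Z s \<omega>) ?W \<in> lifts"
        using measurable_space[OF mZ] by (auto simp: lifts_def history_def)
      moreover have "\<omega> \<in> history M Z t l (restrict (\<lambda>s. Z s \<omega>) ?W) \<inter> C"
        using \<omega> by (auto simp: history_def)
      ultimately show "\<omega> \<in> (\<Union>x\<in>lifts. history M Z t l x \<inter> C)" by blast
    next
      fix \<omega> assume "\<omega> \<in> (\<Union>x\<in>lifts. history M Z t l x \<inter> C)"
      then show "\<omega> \<in> ?H \<inter> C" by (auto simp: history_def lifts_def PiE_iff)
    qed
    have disjoint: "disjoint_family_on (\<lambda>x. history M Z t l x \<inter> C) lifts"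
    proof (unfold disjoint_family_on_def, intro ballI impI)
      fix x y assume "x \<in> lifts" "y \<in> lifts" "x \<noteq> y"
      then obtain s where "s \<in> ?W" "x s \<noteq> y s"
        using PiE_ext[of x ?W _ y] unfolding lifts_def by blast
      then show "(history M Z t l x \<inter> C) \<inter> (history M Z t l y \<inter> C) = {}"
        by (force simp: history_def)
    qed
    have "(\<lambda>x. history M Z t l x \<inter> C) ` lifts \<subseteq> events" using HZ that by blast
    then show ?thesis
      unfolding union by (rule finite_measure_finite_Union[OF fin _ disjoint])
  qed
  have step: "prob (history M Z t l x \<inter> ?E)
      = prob (history M Z t l x) / real (out_degree (with_proj H) (w (t - 1)))"
    if x: "x \<in> lifts" for x
  proof -
    let ?B = "{z \<in> pverts G. f z = v}" and ?d = "out_degree (with_proj G) (x (t - 1))"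
    have xG: "\<forall>s\<in>?W. x s \<in> pverts G" and fx: "f (x (t - 1)) = w (t - 1)" "x (t - 1) \<in> pverts G"
      using x l by (auto simp: lifts_def PiE_iff)
    have union: "history M Z t l x \<inter> ?E
        = (\<Union>z\<in>?B. history M Z t l x \<inter> {\<omega> \<in> space M. Z t \<omega> = z})"
      using measurable_space[OF mZ] by (auto simp: history_def)
    have "prob (history M Z t l x \<inter> ?E)
        = (\<Sum>z\<in>?B. prob (history M Z t l x \<inter> {\<omega> \<in> space M. Z t \<omega> = z}))"
      unfolding union using G.pair_finite_verts HZ EZ
      by (intro finite_measure_finite_Union) (auto simp: disjoint_family_on_def)
    also have "\<dots> = (\<Sum>z\<in>?B. if (x (t - 1), z) \<in> parcs G then prob (history M Z t l x) / ?d else 0)"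
      by (intro sum.cong refl simple_random_walk_prob_step[OF Z G l xG] deg fx)
    also have "\<dots> = real (card {z. (x (t - 1), z) \<in> parcs G \<and> f z = v}) * (prob (history M Z t l x) / ?d)"
    proof -
      have "{z \<in> ?B. (x (t - 1), z) \<in> parcs G} = {z. (x (t - 1), z) \<in> parcs G \<and> f z = v}"
        by (auto dest: G.pair_arc_in_verts)
      then show ?thesis
        using G.pair_finite_verts by (simp add: sum.If_cases Int_def)
    qed
    also have "\<dots> = prob (history M Z t l x) / real (out_degree (with_proj H) (w (t - 1)))"
    proof -
      have cancel: "real c * (P / real d) = P / real h" if "c * h = d" "d > 0"
        for c h d :: nat and P :: real
        using that by (auto simp: field_simps)
      show ?thesis
        using equitable[OF fx(2), of v] v fx(1) deg[OF fx(2)] by (intro cancel) simp_all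
    qed
    finally show ?thesis .
  qed
  have "prob (?H \<inter> ?E) = (\<Sum>x\<in>lifts. prob (history M Z t l x \<inter> ?E))"
    by (rule split) (rule EZ)
  also have "\<dots> = (\<Sum>x\<in>lifts. prob (history M Z t l x)) / real (out_degree (with_proj H) (w (t - 1)))"
    by (simp add: step sum_divide_distrib)
  also have "(\<Sum>x\<in>lifts. prob (history M Z t l x)) = prob ?H"
    using split[of "space M"] by (simp add: history_def Int_def conj_ac)
  finally show "prob (?H \<inter> ?E) = prob ?H / real (out_degree (with_proj H) (w (t - 1)))" .
qed

section \<open>A two-sided random walk on a Cayley graph\<close>

definition cayley_graph :: "'b set \<Rightarrow> ('b \<Rightarrow> 'b) set \<Rightarrow> ('b \<Rightarrow> 'b) pair_pre_digraph" where
  "cayley_graph S T =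
     \<lparr> pverts = {p. p permutes S}, parcs = {(p, p \<circ> g) |p g. p permutes S \<and> g \<in> T} \<rparr>"

lemma comp_left_cancel:
  assumes "inj f" "f \<circ> g = f \<circ> h"
  shows "g = h"
  using assms by (metis comp_apply ext injD)

lemma comp_right_cancel:
  assumes "surj h" "f \<circ> h = g \<circ> h"
  shows "f = g"
  using assms by (metis comp_apply ext surjD)

lemma pair_fin_digraph_cayley_graph:
  assumes "finite S" and T: "\<And>g. g \<in> T \<Longrightarrow> g permutes S"
  shows "pair_fin_digraph (cayley_graph S T)"
proof -
  have sub: "parcs (cayley_graph S T) \<subseteq> {p. p permutes S} \<times> {p. p permutes S}"
    using T by (auto simp: cayley_graph_def intro: permutes_compose)
  have fin: "finite {p. p permutes S}" using assms(1) by (rule finite_permutations)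
  have "finite (parcs (cayley_graph S T))"
    by (rule finite_subset[OF sub]) (simp add: fin)
  then show ?thesis
    using fin T by unfold_locales (auto simp: cayley_graph_def permutes_compose)
qed

lemma cayley_graph_arc_unique:
  assumes "p permutes S" "p \<circ> g = p \<circ> h"
  shows "g = h"
  using assms permutes_inj comp_left_cancel by metis

lemma out_degree_cayley_graph:
  assumes "p permutes S"
  shows "out_degree (with_proj (cayley_graph S T)) p = card T"
proof -
  have "{q. (p, q) \<in> parcs (cayley_graph S T)} = (\<lambda>g. p \<circ> g) ` T"
    using assms by (auto simp: cayley_graph_def)
  moreover have "inj_on (\<lambda>g. p \<circ> g) T"
    using cayley_graph_arc_unique[OF assms] by (intro inj_onI)
  ultimately show ?thesis by (simp add: out_degree_with_proj card_image)
qed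

text \<open>
  The increment \<open>g t\<close> leads from time \<open>t - 1\<close> to time \<open>t\<close>.  The position at time \<open>t\<close>, relative to
  the position at time 0, is therefore \<open>g 1 \<circ> \<dots> \<circ> g t\<close> for positive times and
  \<open>(g 0)\<^sup>-\<^sup>1 \<circ> (g (-1))\<^sup>-\<^sup>1 \<circ> \<dots> \<circ> (g (t + 1))\<^sup>-\<^sup>1\<close> for negative ones.
\<close>

primrec forward_product :: "(int \<Rightarrow> 'b \<Rightarrow> 'b) \<Rightarrow> nat \<Rightarrow> 'b \<Rightarrow> 'b" where
  "forward_product g 0 = id"
| "forward_product g (Suc m) = forward_product g m \<circ> g (int m + 1)"

primrec backward_product :: "(int \<Rightarrow> 'b \<Rightarrow> 'b) \<Rightarrow> nat \<Rightarrow> 'b \<Rightarrow> 'b" where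
  "backward_product g 0 = id"
| "backward_product g (Suc m) = backward_product g m \<circ> inv (g (- int m))"

definition displacement :: "(int \<Rightarrow> 'b \<Rightarrow> 'b) \<Rightarrow> int \<Rightarrow> 'b \<Rightarrow> 'b" where
  "displacement g t =
     (if t \<ge> 0 then forward_product g (nat t) else backward_product g (nat (- t)))"

lemma displacement_step:
  assumes "inj (g t)"
  shows "displacement g t = displacement g (t - 1) \<circ> g t"
proof (cases "t \<ge> 1")
  case True
  define m where "m = nat (t - 1)"
  have "t = int m + 1" using True by (simp add: m_def)
  then show ?thesis by (simp add: displacement_def nat_add_distrib)
next
  case False
  define m where "m = nat (- t)"
  have t: "t = - int m" using False by (simp add: m_def)
  have "displacement g (t - 1) = backward_product g (Suc m)"
    by (simp add: displacement_def t nat_add_distrib)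
  then have "displacement g (t - 1) \<circ> g t = backward_product g m \<circ> (inv (g t) \<circ> g t)"
    by (simp add: t o_assoc)
  also have "\<dots> = backward_product g m"
    using assms by simp
  also have "\<dots> = displacement g t"
    by (cases m) (simp_all add: displacement_def t nat_add_distrib)
  finally show ?thesis ..
qed

lemma measurable_displacement:
  assumes "finite S" and g: "\<And>t. (\<lambda>\<omega>. g \<omega> t) \<in> measurable M (count_space {p. p permutes S})"
  shows "(\<lambda>\<omega>. displacement (g \<omega>) t) \<in> measurable M (count_space {p. p permutes S})"
proof -
  let ?P = "{p. p permutes S}"
  have P: "countable ?P" using finite_permutations[OF assms(1)] by (rule countable_finite)
  have comp: "(\<lambda>\<omega>. a \<omega> \<circ> b \<omega>) \<in> measurable M (count_space ?P)"
    if "a \<in> measurable M (count_space ?P)" "b \<in> measurable M (count_space ?P)" for a b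
    by (rule measurable_count_space_comp2[where h = "(\<circ>)", OF that P P]) (simp add: permutes_compose)
  have inv: "(\<lambda>\<omega>. inv (g \<omega> t)) \<in> measurable M (count_space ?P)" for t
    by (rule measurable_count_space_comp[OF g]) (simp add: permutes_inv)
  have id: "(\<lambda>_. id) \<in> measurable M (count_space ?P)"
    by (rule measurable_const) (simp add: permutes_id)
  have "(\<lambda>\<omega>. forward_product (g \<omega>) m) \<in> measurable M (count_space ?P)" for m
    by (induction m) (simp_all only: forward_product.simps id comp g)
  moreover have "(\<lambda>\<omega>. backward_product (g \<omega>) m) \<in> measurable M (count_space ?P)" for m
    by (induction m) (simp_all only: backward_product.simps id comp inv)
  ultimately show ?thesis by (simp add: displacement_def)
qed

text \<open>
  The walk is \<open>\<sigma>\<^sub>t = s \<circ> displacement g t\<close> with uniform \<open>s\<close> and independent increments \<open>g\<^sub>r\<close>, uniform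
  on \<open>T\<close>.  For fixed \<open>g\<close>, right multiplication by the displacement preserves the uniform
  distribution of \<open>s\<close>; hence \<open>\<sigma>\<^sub>t\<^sub>-\<^sub>1\<close> is uniform and independent of all increments at once, those
  before and those after time \<open>t\<close>.  Without the random anchor \<open>s\<close> this would fail for \<open>t \<le> 0\<close>, where
  \<open>\<sigma>\<^sub>t\<^sub>-\<^sub>1\<close> is computed from the later increments.  A history of \<open>\<sigma>\<close> before time \<open>t\<close> amounts to the
  value of \<open>\<sigma>\<^sub>t\<^sub>-\<^sub>1\<close> together with finitely many increments, so \<open>g\<^sub>t\<close> is independent of it.
\<close>

lemma exists_simple_random_walk_cayley_graph:
  fixes T :: "('b \<Rightarrow> 'b) set"
  assumes S: "finite S" and T: "\<And>g. g \<in> T \<Longrightarrow> g permutes S" and "T \<noteq> {}"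
  shows "\<exists>(Q :: (('b \<Rightarrow> 'b) \<times> (int \<Rightarrow> 'b \<Rightarrow> 'b)) measure) \<sigma>.
    simple_random_walk Q (cayley_graph S T) \<sigma>"
proof -
  let ?P = "{p. p permutes S}"
  have finP: "finite ?P" using S by (rule finite_permutations)
  have finT: "finite T" using T by (intro finite_subset[OF _ finP]) auto
  have neP: "?P \<noteq> {}" using permutes_id by blast
  define start where "start = uniform_count_measure ?P"
  define incs where "incs = PiM (UNIV :: int set) (\<lambda>_. uniform_count_measure T)"
  define Q where "Q = start \<Otimes>\<^sub>M incs"
  define \<sigma> where "\<sigma> = (\<lambda>t (s, g). s \<circ> displacement g t :: 'b \<Rightarrow> 'b)"
  interpret start: prob_space start
    unfolding start_def using finP neP by (rule prob_space_uniform_count_measure)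
  interpret inc: prob_space "uniform_count_measure T"
    using finT \<open>T \<noteq> {}\<close> by (rule prob_space_uniform_count_measure)
  interpret incs: product_prob_space "\<lambda>_. uniform_count_measure T" "UNIV :: int set" ..
  interpret incs: prob_space incs
    unfolding incs_def by (rule incs.prob_space_axioms)
  interpret Q: pair_prob_space start incs ..
  have space_start: "space start = ?P" and sets_start: "sets start = Pow ?P"
    by (simp_all add: start_def space_uniform_count_measure sets_uniform_count_measure)
  have space_incs: "space incs = {g. \<forall>r. g r \<in> T}"
    by (auto simp: incs_def space_PiM space_uniform_count_measure PiE_def)
  have m_start: "(\<lambda>s. s) \<in> measurable start (count_space ?P)"
    by (simp add: measurable_def space_start sets_start)
  have m_incs: "(\<lambda>g. g r) \<in> measurable incs (count_space T)" for r
  proof -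
    have "(\<lambda>g. g r) \<in> measurable incs (uniform_count_measure T)"
      unfolding incs_def by (rule measurable_component_singleton) simp
    then show ?thesis
      by (simp add: measurable_cong_sets[OF refl sets_uniform_count_measure_count_space])
  qed
  have m_disp: "(\<lambda>g. displacement g t) \<in> measurable incs (count_space ?P)" for t
    by (rule measurable_displacement[OF S measurable_count_space_comp[OF m_incs]]) (simp add: T)
  have m_\<sigma>: "\<sigma> t \<in> measurable Q (count_space ?P)" for t
    unfolding \<sigma>_def Q_def case_prod_beta
    by (rule measurable_count_space_comp2[where h = "(\<circ>)",
        OF measurable_compose[OF measurable_fst m_start] measurable_compose[OF measurable_snd m_disp]])
      (simp_all add: countable_finite[OF finP] permutes_compose)
  have disp: "displacement g t permutes S" if "g \<in> space incs" for g t
    using measurable_space[OF m_disp that] by simp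
  have step: "\<sigma> t (s, g) = \<sigma> (t - 1) (s, g) \<circ> g t" if "g \<in> space incs" for t s g
  proof -
    have "inj (g t)" using T permutes_inj that by (auto simp: space_incs)
    then have "displacement g t = displacement g (t - 1) \<circ> g t" by (rule displacement_step)
    then show ?thesis by (simp add: \<sigma>_def comp_assoc)
  qed

  \<comment> \<open>the position at time \<open>t\<close> is uniform and independent of the sequence of increments:
    given \<open>g\<close>, exactly one value of \<open>s\<close> leads to \<open>p\<close>\<close>
  have uniform: "measure Q {x \<in> space Q. \<sigma> t x = p \<and> snd x \<in> B} = measure incs B / card ?P"
    if p: "p permutes S" and B: "B \<in> sets incs" for t p B
  proof -
    let ?X = "{x \<in> space Q. \<sigma> t x = p \<and> snd x \<in> B}"
    have "?X = {x \<in> space Q. \<sigma> t x = p} \<inter> (space start \<times> B)"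
      using sets.sets_into_space[OF B] by (auto simp: Q_def space_pair_measure)
    moreover have "space start \<times> B \<in> sets Q" unfolding Q_def using B by simp
    ultimately have X: "?X \<in> sets Q"
      using sets_Collect_count_space[OF m_\<sigma>[of t], of "\<lambda>q. q = p"] by simp
    have sec: "emeasure start ((\<lambda>s. (s, g)) -` ?X) = ennreal (1 / card ?P) * indicator B g"
      if g: "g \<in> space incs" for g
    proof -
      let ?d = "displacement g t"
      have d: "?d permutes S" using g by (rule disp)
      have iff: "s \<circ> ?d = p \<longleftrightarrow> s = p \<circ> inv ?d" for s
        using permutes_inv_o[OF d] by (metis comp_assoc comp_id)
      have "p \<circ> inv ?d permutes S" using d p by (simp add: permutes_compose permutes_inv)
      then have "(\<lambda>s. (s, g)) -` ?X = (if g \<in> B then {p \<circ> inv ?d} else {})"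
        using g by (auto simp: Q_def space_pair_measure space_start \<sigma>_def iff)
      then show ?thesis
        using \<open>p \<circ> inv ?d permutes S\<close> finP
        by (simp add: start_def emeasure_uniform_count_measure)
    qed
    have "emeasure Q ?X = (\<integral>\<^sup>+g. emeasure start ((\<lambda>s. (s, g)) -` ?X) \<partial>incs)"
      unfolding Q_def by (rule Q.emeasure_pair_measure_alt2) (use X in \<open>simp add: Q_def\<close>)
    also have "\<dots> = (\<integral>\<^sup>+g. ennreal (1 / card ?P) * indicator B g \<partial>incs)"
      by (rule nn_integral_cong) (rule sec)
    also have "\<dots> = ennreal (1 / card ?P) * emeasure incs B"
      using B by (rule nn_integral_cmult_indicator)
    finally show ?thesis by (simp add: measure_def enn2real_mult)
  qed

  define cyl where "cyl J b = {g \<in> space incs. \<forall>r\<in>J. g r = b r}"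
    for J :: "int set" and b :: "int \<Rightarrow> 'b \<Rightarrow> 'b"
  have cyl_sets: "cyl J b \<in> sets incs" if "finite J" for J b
    unfolding cyl_def using that
    by (intro sets.sets_Collect_finite_All sets_Collect_count_space[OF m_incs])
  have cyl: "measure incs (cyl J b) = (1 / card T) ^ card J"
    if "finite J" "\<And>r. r \<in> J \<Longrightarrow> b r \<in> T" for J b
  proof -
    have "emeasure incs (cyl J b) = (\<Prod>r\<in>J. emeasure (uniform_count_measure T) {b r})"
      using incs.emeasure_PiM_Collect[of J "\<lambda>r. {b r}"] that
      by (simp add: cyl_def incs_def sets_uniform_count_measure)
    also have "\<dots> = (\<Prod>r\<in>J. ennreal (1 / card T))"
      using that finT by (intro prod.cong refl) (simp add: emeasure_uniform_count_measure)
    finally show ?thesis by (simp add: measure_def ennreal_power)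
  qed

  have "simple_random_walk Q (cayley_graph S T) \<sigma>"
  proof (rule simple_random_walkI)
    show "prob_space Q" unfolding Q_def by (rule Q.prob_space_axioms)
    show "\<sigma> t \<in> measurable Q (count_space (pverts (cayley_graph S T)))" for t
      using m_\<sigma> by (simp add: cayley_graph_def)
    fix t :: int and l :: nat and w v
    assume l: "1 \<le> l" and w: "\<forall>s\<in>{t - int l..t - 1}. w s \<in> pverts (cayley_graph S T)"
      and v: "(w (t - 1), v) \<in> parcs (cayley_graph S T)"
    let ?J = "{t - int l + 1..t - 1}" and ?H = "history Q \<sigma> t l w"
    have w: "w s permutes S" if "s \<in> {t - int l..t - 1}" for s
      using w that by (simp add: cayley_graph_def)
    have wt: "w (t - 1) permutes S" using l by (intro w) simp
    obtain h where h: "h \<in> T" "v = w (t - 1) \<circ> h" using v by (auto simp: cayley_graph_def)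
    show "measure Q (?H \<inter> {x \<in> space Q. \<sigma> t x = v})
      = measure Q ?H / real (out_degree (with_proj (cayley_graph S T)) (w (t - 1)))"
    proof (cases "\<forall>r\<in>?J. \<exists>b\<in>T. w r = w (r - 1) \<circ> b")
      case True
      then obtain b where b: "b r \<in> T" "w r = w (r - 1) \<circ> b r" if "r \<in> ?J" for r by metis
      \<comment> \<open>the last position and the increments determine the earlier positions by undoing the
        increments one at a time, and the positions determine the increments\<close>
      have hist_iff: "x \<in> ?H \<longleftrightarrow> \<sigma> (t - 1) x = w (t - 1) \<and> snd x \<in> cyl ?J b"
        if x: "x \<in> space Q" for x
      proof -
        obtain s g where sg: "x = (s, g)" "g \<in> space incs"
          using x by (auto simp: Q_def space_pair_measure)
        have x_step: "\<sigma> r x = \<sigma> (r - 1) x \<circ> g r" for r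
          unfolding sg(1) by (rule step[OF sg(2)])
        show ?thesis
        proof
          assume "x \<in> ?H"
          then have eq: "\<sigma> s x = w s" if "s \<in> {t - int l..t - 1}" for s
            using that by (auto simp: history_def)
          have "g r = b r" if r: "r \<in> ?J" for r
          proof -
            have "w (r - 1) \<circ> g r = w (r - 1) \<circ> b r"
              using x_step[of r] eq[of r] eq[of "r - 1"] b(2)[OF r] r by simp
            moreover have "w (r - 1) permutes S" using r by (intro w) auto
            ultimately show ?thesis using cayley_graph_arc_unique by blast
          qed
          then show "\<sigma> (t - 1) x = w (t - 1) \<and> snd x \<in> cyl ?J b"
            using eq[of "t - 1"] l sg by (simp add: cyl_def)
        next
          assume "\<sigma> (t - 1) x = w (t - 1) \<and> snd x \<in> cyl ?J b"
          then have last: "\<sigma> (t - 1) x = w (t - 1)" and gb: "\<And>r. r \<in> ?J \<Longrightarrow> g r = b r"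
            by (simp_all add: cyl_def sg)
          have "\<sigma> (t - 1 - int m) x = w (t - 1 - int m)" if "m < l" for m
            using that
          proof (induction m)
            case 0
            then show ?case using last by simp
          next
            case (Suc m)
            let ?r = "t - 1 - int m"
            have r: "?r \<in> ?J" using Suc.prems by simp
            have "\<sigma> ?r x = w ?r" using Suc by simp
            then have "\<sigma> (?r - 1) x \<circ> b ?r = w (?r - 1) \<circ> b ?r"
              using x_step[of ?r] gb[OF r] b(2)[OF r] by metis
            moreover have "surj (b ?r)" using T[OF b(1)[OF r]] by (rule permutes_surj)
            ultimately have "\<sigma> (?r - 1) x = w (?r - 1)" by (metis comp_right_cancel)
            then show ?case by (simp add: algebra_simps)
          qed
          then have from_last: "\<sigma> (t - 1 - int m) x = w (t - 1 - int m)" if "m < l" for m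
            using that by blast
          have "\<sigma> s x = w s" if "s \<in> {t - int l..t - 1}" for s
            using from_last[of "nat (t - 1 - s)"] that by auto
          then show "x \<in> ?H" using x by (simp add: history_def)
        qed
      qed
      let ?b = "b(t := h)"
      have "?H = {x \<in> space Q. \<sigma> (t - 1) x = w (t - 1) \<and> snd x \<in> cyl ?J b}"
        using hist_iff by (auto simp: history_def)
      then have H: "measure Q ?H = (1 / card T) ^ card ?J / card ?P"
        using uniform[OF wt cyl_sets] cyl[of ?J b] b(1) by simp
      have last_iff: "\<sigma> t x = v \<longleftrightarrow> snd x t = h"
        if x: "x \<in> space Q" "\<sigma> (t - 1) x = w (t - 1)" for x
      proof -
        have "snd x \<in> space incs" using x(1) by (auto simp: Q_def space_pair_measure)
        from step[OF this, of t "fst x"] have "\<sigma> t x = w (t - 1) \<circ> snd x t"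
          unfolding prod.collapse x(2) .
        then show ?thesis using cayley_graph_arc_unique[OF wt] h(2) by auto
      qed
      have step_event: "?H \<inter> {x \<in> space Q. \<sigma> t x = v}
          = {x \<in> space Q. \<sigma> (t - 1) x = w (t - 1) \<and> snd x \<in> cyl (insert t ?J) ?b}"
      proof (rule set_eqI)
        fix x :: "('b \<Rightarrow> 'b) \<times> (int \<Rightarrow> 'b \<Rightarrow> 'b)"
        have "snd x \<in> cyl (insert t ?J) ?b \<longleftrightarrow> snd x \<in> cyl ?J b \<and> snd x t = h"
          by (auto simp: cyl_def)
        moreover have "x \<in> ?H \<Longrightarrow> x \<in> space Q" by (simp add: history_def)
        ultimately show "x \<in> ?H \<inter> {x \<in> space Q. \<sigma> t x = v} \<longleftrightarrow>
            x \<in> {x \<in> space Q. \<sigma> (t - 1) x = w (t - 1) \<and> snd x \<in> cyl (insert t ?J) ?b}"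
          using hist_iff[of x] last_iff[of x] by blast
      qed
      have "measure Q (?H \<inter> {x \<in> space Q. \<sigma> t x = v}) = (1 / card T) ^ card (insert t ?J) / card ?P"
      proof -
        have "measure incs (cyl (insert t ?J) ?b) = (1 / card T) ^ card (insert t ?J)"
          using b(1) h(1) by (intro cyl) auto
        then show ?thesis
          unfolding step_event using uniform[OF wt cyl_sets] by simp
      qed
      then show ?thesis
        using H by (simp add: out_degree_cayley_graph[OF wt])
    next
      case False
      then obtain r where r: "r \<in> ?J" "\<And>b. b \<in> T \<Longrightarrow> w r \<noteq> w (r - 1) \<circ> b" by blast
      have "?H = {}"
      proof (rule ccontr)
        assume "?H \<noteq> {}"
        then obtain s g where x: "(s, g) \<in> ?H" by auto
        then have g: "g \<in> space incs" by (auto simp: history_def Q_def space_pair_measure)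
        have "\<sigma> r (s, g) = w r" "\<sigma> (r - 1) (s, g) = w (r - 1)"
          using x r(1) by (auto simp: history_def)
        then show False using step[OF g, of r s] r(2)[of "g r"] g by (simp add: space_incs)
      qed
      then show ?thesis by simp
    qed
  qed
  then show ?thesis by blast
qed

section \<open>Avoidance couplings: almost sure avoidance and image measures\<close>

lemma finite_coupling_configurations:
  "finite V \<Longrightarrow> finite ({1..k} \<rightarrow>\<^sub>E V)" for k :: nat
  by (intro finite_PiE) auto

lemma simple_avoidance_coupling_AE:
  assumes U: "simple_avoidance_coupling M k G U" and G: "finite (pverts G)"
    and ij: "i \<in> {1..k}" "j \<in> {1..k}" "i < j"
  shows "AE \<omega> in M. U t \<omega> i \<noteq> U t \<omega> j \<and> U t \<omega> i \<noteq> U (t - 1) \<omega> j"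
proof -
  interpret prob_space M using U by (simp add: simple_avoidance_coupling_def)
  let ?E = "{1..k} \<rightarrow>\<^sub>E pverts G"
  have E: "countable ?E" using finite_coupling_configurations[OF G] by (rule countable_finite)
  have mU: "U t \<in> measurable M (count_space ?E)" for t
    using U by (simp add: simple_avoidance_coupling_def)
  have m2: "{\<omega> \<in> space M. U t \<omega> i = U (t - 1) \<omega> j} \<in> sets M"
    using sets_Collect_count_space[OF measurable_count_space_Pair[OF mU mU E E],
        of "\<lambda>(a, b). a i = b j" t "t - 1"] by simp
  have m1: "{\<omega> \<in> space M. U t \<omega> i = U t \<omega> j} \<in> sets M"
    using sets_Collect_count_space[OF mU, of "\<lambda>a. a i = a j" t] .
  have "prob {\<omega> \<in> space M. U t \<omega> i = U t \<omega> j} = 0"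
    "prob {\<omega> \<in> space M. U t \<omega> i = U (t - 1) \<omega> j} = 0"
    using U ij unfolding simple_avoidance_coupling_def by auto
  then have "AE \<omega> in M. \<omega> \<notin> {\<omega> \<in> space M. U t \<omega> i = U t \<omega> j}"
    "AE \<omega> in M. \<omega> \<notin> {\<omega> \<in> space M. U t \<omega> i = U (t - 1) \<omega> j}"
    using m1 m2 by (simp_all add: prob_eq_0)
  then show ?thesis using AE_space by eventually_elim simp
qed

text \<open>
  Being an avoidance coupling is a property of the joint law, so a coupling may be moved to any
  space that carries its image measure.  Finiteness of the graph makes the events comparing two
  walkers at different times measurable.
\<close>

lemma simple_avoidance_coupling_distr:
  assumes \<phi>: "\<phi> \<in> measurable M M'" and G: "finite (pverts G)"
    and Y: "\<And>t. Y t \<in> measurable M' (count_space ({1..k} \<rightarrow>\<^sub>E pverts G))"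
    and sac: "simple_avoidance_coupling M k G (\<lambda>t \<omega>. Y t (\<phi> \<omega>))"
  shows "simple_avoidance_coupling (distr M M' \<phi>) k G Y"
proof -
  interpret prob_space M using sac by (simp add: simple_avoidance_coupling_def)
  let ?E = "{1..k} \<rightarrow>\<^sub>E pverts G"
  have E: "countable ?E" using finite_coupling_configurations[OF G] by (rule countable_finite)
  have prob: "\<P>(x in distr M M' \<phi>. P x) = \<P>(\<omega> in M. P (\<phi> \<omega>))"
    if "{x \<in> space M'. P x} \<in> sets M'" for P
    using measure_distr[OF \<phi> that] measurable_space[OF \<phi>]
    by (auto intro!: arg_cong[where f = "measure M"])
  have m2: "{x \<in> space M'. Y s x i = Y t x j} \<in> sets M'" for s t i j
    using sets_Collect_count_space[OF measurable_count_space_Pair[OF Y Y E E],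
        of "\<lambda>(a, b). a i = b j" s t] by simp
  have "simple_random_walk (distr M M' \<phi>) G (\<lambda>t x. Y t x i)" if "i \<in> {1..k}" for i
  proof (rule simple_random_walk_distr[OF \<phi>])
    show "(\<lambda>x. Y t x i) \<in> measurable M' (count_space (pverts G))" for t
      by (rule measurable_count_space_comp[OF Y]) (use that in auto)
    show "simple_random_walk M G (\<lambda>t \<omega>. Y t (\<phi> \<omega>) i)"
      using sac that by (simp add: simple_avoidance_coupling_def)
  qed
  then show ?thesis
    using sac Y prob_space_distr[OF \<phi>]
    unfolding simple_avoidance_coupling_def measurable_distr_eq1 prob[OF m2] by blast
qed

lemma AE_pair_fst:
  assumes "AE x in M. P x" and "sigma_finite_measure Q"
  shows "AE z in M \<Otimes>\<^sub>M Q. P (fst z)"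
proof -
  interpret Q: sigma_finite_measure Q by fact
  obtain N where N: "{x \<in> space M. \<not> P x} \<subseteq> N" "N \<in> null_sets M"
    using assms(1) unfolding eventually_ae_filter by auto
  have "N \<times> space Q \<in> null_sets (M \<Otimes>\<^sub>M Q)" using N(2) by (intro Q.times_in_null_sets1) auto
  then show ?thesis by (rule AE_I') (use N(1) in \<open>auto simp: space_pair_measure\<close>)
qed

lemma AE_pair_snd:
  assumes "AE y in Q. P y" and "sigma_finite_measure Q"
  shows "AE z in M \<Otimes>\<^sub>M Q. P (snd z)"
proof -
  interpret Q: sigma_finite_measure Q by fact
  obtain N where N: "{x \<in> space Q. \<not> P x} \<subseteq> N" "N \<in> null_sets Q"
    using assms(1) unfolding eventually_ae_filter by auto
  have "space M \<times> N \<in> null_sets (M \<Otimes>\<^sub>M Q)" using N(2) by (intro Q.times_in_null_sets2) auto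
  then show ?thesis by (rule AE_I') (use N(1) in \<open>auto simp: space_pair_measure\<close>)
qed

section \<open>Relabelling by a random walk of star transpositions\<close>

lemma pair_fin_digraph_complete_graph_on: "pair_fin_digraph (complete_graph_on n)"
proof
  show "finite (parcs (complete_graph_on n))"
    by (rule finite_subset[of _ "{1..n} \<times> {1..n}"]) (auto simp: complete_graph_on_def)
qed (auto simp: complete_graph_on_def)

text \<open>
  Composing a permutation \<open>p\<close> on the right with \<open>(b N)\<close> exchanges the vertices \<open>p b\<close> and \<open>p N\<close> of the
  labels \<open>b\<close> and \<open>N\<close>.
\<close>

definition star_transpositions :: "nat \<Rightarrow> (nat \<Rightarrow> nat) set" where
  "star_transpositions N = (\<lambda>b. Transposition.transpose b N) ` {1..N - 1}"

lemma transpose_inject_left: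
  "Transposition.transpose a c = Transposition.transpose b c \<Longrightarrow> a = b"
  by (metis transpose_apply_second)

lemma card_star_transpositions: "card (star_transpositions N) = N - 1"
  unfolding star_transpositions_def
  by (subst card_image) (auto intro: inj_onI transpose_inject_left)

lemma star_transpositions_permutes:
  assumes "g \<in> star_transpositions N"
  shows "g permutes {1..N}"
  using assms by (auto simp: star_transpositions_def intro!: permutes_swap_id)

text \<open>
  Let \<open>c\<close> be the label of the target \<open>v\<close> under \<open>p\<close>; then \<open>c \<noteq> x\<close>.  A lift is a new label \<open>y \<noteq> x\<close>
  together with a transposition \<open>(b N)\<close> that takes \<open>y\<close> to \<open>c\<close>.  If \<open>v\<close> is the hole, that is
  \<open>c = N\<close>, this forces \<open>b = y\<close>, and \<open>y\<close> can be anything but \<open>x\<close>.  Otherwise it forces \<open>y = c\<close>, and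
  \<open>b\<close> can be anything but \<open>c\<close>.  In both cases \<open>N - 2\<close> choices remain, and this agreement is why
  the hole is as likely a destination as every other vertex.
\<close>

lemma card_lifts_evaluation:
  assumes x: "x \<in> {1..N - 1}" and p: "p permutes {1..N}" and v: "v \<in> {1..N}" "v \<noteq> p x"
  shows "card {z. ((x, p), z) \<in> parcs (tensor_product (complete_graph_on (N - 1))
      (cayley_graph {1..N} (star_transpositions N))) \<and> (snd z) (fst z) = v} = N - 2"
    (is "card ?L = _")
proof -
  define c where "c = inv p v"
  have pc: "p c = v" using p by (simp add: c_def permutes_inverses)
  have c: "c \<in> {1..N}" "c \<noteq> x"
    using pc v permutes_in_image[OF p, of c] by auto
  let ?F = "\<lambda>(y, b). (y, p \<circ> Transposition.transpose b N)"
  define D where "D = {(y, b) \<in> {1..N - 1} \<times> {1..N - 1}. y \<noteq> x \<and> (if y = b then N else y) = c}"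
  have swap: "Transposition.transpose b N y = (if y = b then N else y)" if "y \<in> {1..N - 1}" for b y
    using that by (auto simp: Transposition.transpose_def)
  have "?L = {(y, p \<circ> Transposition.transpose b N) |y b. y \<in> {1..N - 1} \<and> y \<noteq> x \<and> b \<in> {1..N - 1}
      \<and> Transposition.transpose b N y = c}"
    using x p unfolding pc[symmetric]
    by (auto simp: tensor_product_def complete_graph_on_def cayley_graph_def
        star_transpositions_def inj_eq[OF permutes_inj[OF p]])
  also have "\<dots> = ?F ` D"
    using swap unfolding D_def by fastforce
  finally have "card ?L = card (?F ` D)" by simp
  moreover have "inj_on ?F D"
  proof (rule inj_onI)
    fix z z' assume "?F z = ?F z'"
    then have "fst z = fst z'" and "p \<circ> Transposition.transpose (snd z) N = p \<circ> Transposition.transpose (snd z') N"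
      by (simp_all add: case_prod_beta)
    from this(1) transpose_inject_left[OF comp_left_cancel[OF permutes_inj[OF p] this(2)]]
    show "z = z'" by (rule prod_eqI)
  qed
  ultimately have card_L: "card ?L = card D" by (simp add: card_image)
  show ?thesis
  proof (cases "c = N")
    case True
    have "D = (\<lambda>b. (b, b)) ` ({1..N - 1} - {x})"
      unfolding D_def True by (auto split: if_splits)
    moreover have "card ({1..N - 1} - {x}) = N - 2" using x by simp
    ultimately show ?thesis unfolding card_L by (simp add: card_image inj_on_def)
  next
    case False
    have "D = {c} \<times> ({1..N - 1} - {c})"
      unfolding D_def using False c by (auto split: if_splits)
    moreover have "c \<in> {1..N - 1}" using c(1) False by auto
    then have "card ({1..N - 1} - {c}) = N - 2" by simp
    ultimately show ?thesis unfolding card_L by (simp add: card_cartesian_product)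
  qed
qed

lemma simple_random_walk_relabel:
  assumes "N \<ge> 3" and X: "simple_random_walk M (complete_graph_on (N - 1)) X"
    and \<sigma>: "simple_random_walk Q (cayley_graph {1..N} (star_transpositions N)) \<sigma>"
  shows "simple_random_walk (M \<Otimes>\<^sub>M Q) (complete_graph_on N) (\<lambda>t (\<omega>, q). \<sigma> t q (X t \<omega>))"
proof -
  let ?K = "complete_graph_on (N - 1)" and ?C = "cayley_graph {1..N} (star_transpositions N)"
  let ?G = "tensor_product ?K ?C"
  have K: "pair_fin_digraph ?K" by (rule pair_fin_digraph_complete_graph_on)
  have C: "pair_fin_digraph ?C"
    by (rule pair_fin_digraph_cayley_graph[OF _ star_transpositions_permutes]) simp
  have verts: "pverts ?G = {1..N - 1} \<times> {p. p permutes {1..N}}"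
    by (simp add: tensor_product_def complete_graph_on_def cayley_graph_def)
  have deg: "out_degree (with_proj ?G) (x, p) = (N - 2) * (N - 1)"
    if "x \<in> {1..N - 1}" "p permutes {1..N}" for x p
    using that by (simp add: out_degree_tensor_product out_degree_complete_graph_on
        out_degree_cayley_graph card_star_transpositions numeral_2_eq_2)
  have range: "p x \<in> {1..N}" if "x \<in> {1..N - 1}" "p permutes {1..N}" for x p
    using that permutes_in_image[OF that(2), of x] by auto
  have "simple_random_walk (M \<Otimes>\<^sub>M Q) (complete_graph_on N)
      (\<lambda>t z. (\<lambda>(x, p). p x) ((\<lambda>t (\<omega>, q). (X t \<omega>, \<sigma> t q)) t z))"
  proof (rule simple_random_walk_image[OF simple_random_walk_tensor_product[OF X \<sigma> K C]
        pair_fin_digraph_tensor_product[OF K C]])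
    fix z assume "z \<in> pverts ?G"
    then obtain x p where z: "z = (x, p)" "x \<in> {1..N - 1}" "p permutes {1..N}"
      unfolding verts by auto
    show "out_degree (with_proj ?G) z > 0" using deg[OF z(2,3)] z(1) assms(1) by simp
    show "(case z of (x, p) \<Rightarrow> p x) \<in> pverts (complete_graph_on N)"
      using range[OF z(2,3)] z(1) by (simp add: complete_graph_on_def)
    fix v assume "((case z of (x, p) \<Rightarrow> p x), v) \<in> parcs (complete_graph_on N)"
    then have v: "v \<in> {1..N}" "v \<noteq> p x" by (auto simp: complete_graph_on_def z(1))
    show "card {z'. (z, z') \<in> parcs ?G \<and> (case z' of (x, p) \<Rightarrow> p x) = v}
        * out_degree (with_proj (complete_graph_on N)) (case z of (x, p) \<Rightarrow> p x)
      = out_degree (with_proj ?G) z"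
      using card_lifts_evaluation[OF z(2,3) v] deg[OF z(2,3)]
        out_degree_complete_graph_on[OF range[OF z(2,3)]]
      by (simp add: z(1) case_prod_beta)
  qed
  then show ?thesis by (simp add: case_prod_beta')
qed

text \<open>
  A transposition \<open>(b N)\<close> sends the label \<open>x\<close> to \<open>x\<close> or to \<open>N\<close>, and \<open>y\<close> is neither of them.
\<close>

lemma relabelled_positions_distinct:
  assumes "(p, q) \<in> parcs (cayley_graph {1..N} (star_transpositions N))"
    and xy: "x \<in> {1..N - 1}" "y \<in> {1..N - 1}" "x \<noteq> y"
  shows "q x \<noteq> q y" "q x \<noteq> p y"
proof -
  obtain b where p: "p permutes {1..N}" and q: "q = p \<circ> Transposition.transpose b N" "b \<in> {1..N - 1}"
    using assms(1) by (auto simp: cayley_graph_def star_transpositions_def)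
  have inj: "p u = p v \<longleftrightarrow> u = v" for u v using permutes_inj[OF p] by (rule inj_eq)
  have "Transposition.transpose b N x \<noteq> Transposition.transpose b N y"
    using xy(3) by (metis transpose_involutory)
  then show "q x \<noteq> q y" by (simp add: q(1) inj)
  have "Transposition.transpose b N x \<noteq> y" using xy by (auto simp: Transposition.transpose_def)
  then show "q x \<noteq> p y" by (simp add: q(1) inj)
qed

lemma simple_avoidance_coupling_relabel:
  assumes N: "N \<ge> 3" and U: "simple_avoidance_coupling M k (complete_graph_on (N - 1)) U"
    and \<sigma>: "simple_random_walk Q (cayley_graph {1..N} (star_transpositions N)) \<sigma>"
  shows "simple_avoidance_coupling (M \<Otimes>\<^sub>M Q) k (complete_graph_on N)
    (\<lambda>t (\<omega>, q). \<lambda>i\<in>{1..k}. \<sigma> t q (U t \<omega> i))"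
    (is "simple_avoidance_coupling ?P k _ ?V")
proof -
  let ?C = "cayley_graph {1..N} (star_transpositions N)"
  let ?E = "{1..k} \<rightarrow>\<^sub>E {1..N - 1}"
  interpret M: prob_space M using U by (simp add: simple_avoidance_coupling_def)
  interpret Q: prob_space Q using \<sigma> by (simp add: simple_random_walk_def)
  interpret MQ: pair_prob_space M Q ..
  have C: "pair_fin_digraph ?C"
    by (rule pair_fin_digraph_cayley_graph[OF _ star_transpositions_permutes]) simp
  have degC: "out_degree (with_proj ?C) p > 0" if "p \<in> pverts ?C" for p
    using that N
    by (subst out_degree_cayley_graph) (simp_all add: cayley_graph_def card_star_transpositions)
  have mU: "U t \<in> measurable M (count_space ?E)" for t
    using U by (simp add: simple_avoidance_coupling_def complete_graph_on_def)
  have m\<sigma>: "\<sigma> t \<in> measurable Q (count_space {p. p permutes {1..N}})" for t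
    using \<sigma> by (simp add: simple_random_walk_def cayley_graph_def)
  have UE: "U t \<omega> i \<in> {1..N - 1}" if "\<omega> \<in> space M" "i \<in> {1..k}" for t \<omega> i
    using measurable_space[OF mU that(1)] that(2) by (auto simp: PiE_iff)
  show ?thesis
    unfolding simple_avoidance_coupling_def
  proof (intro conjI allI ballI impI)
    show "prob_space ?P" by (rule MQ.prob_space_axioms)
    show "?V t \<in> measurable ?P (count_space ({1..k} \<rightarrow>\<^sub>E pverts (complete_graph_on N)))" for t
      unfolding case_prod_beta'
    proof (rule measurable_count_space_comp2[where h = "\<lambda>u p. \<lambda>i\<in>{1..k}. p (u i)",
          OF measurable_compose[OF measurable_fst mU] measurable_compose[OF measurable_snd m\<sigma>]])
      show "countable ?E" by (intro countable_finite finite_coupling_configurations) simp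
      show "countable {p. p permutes {1..N}}" by (intro countable_finite finite_permutations) simp
      fix u p assume "u \<in> ?E" "p \<in> {p. p permutes {1..N}}"
      then have "p (u i) \<in> {1..N}" if "i \<in> {1..k}" for i
        using that permutes_in_image[of p "{1..N}" "u i"] by (force simp: PiE_iff)
      then show "(\<lambda>i\<in>{1..k}. p (u i)) \<in> {1..k} \<rightarrow>\<^sub>E pverts (complete_graph_on N)"
        by (simp add: complete_graph_on_def PiE_iff)
    qed
  next
    fix i assume i: "i \<in> {1..k}"
    have "simple_random_walk M (complete_graph_on (N - 1)) (\<lambda>t \<omega>. U t \<omega> i)"
      using U i by (simp add: simple_avoidance_coupling_def)
    from simple_random_walk_relabel[OF N this \<sigma>]
    show "simple_random_walk ?P (complete_graph_on N) (\<lambda>t \<omega>. ?V t \<omega> i)"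
      using i by (simp add: case_prod_beta')
  next
    fix t i j assume ij: "i \<in> {1..k}" "j \<in> {1..k}" "i < j"
    have "finite (pverts (complete_graph_on (N - 1)))" by (simp add: complete_graph_on_def)
    from AE_pair_fst[OF simple_avoidance_coupling_AE[OF U this ij] Q.sigma_finite_measure_axioms]
    have avoid: "AE z in ?P. U t (fst z) i \<noteq> U t (fst z) j \<and> U t (fst z) i \<noteq> U (t - 1) (fst z) j" .
    have "AE z in ?P. (\<sigma> (t - 1) (snd z), \<sigma> t (snd z)) \<in> parcs ?C"
      by (rule AE_pair_snd[OF simple_random_walk_AE_arc[OF \<sigma> C degC] Q.sigma_finite_measure_axioms])
    with avoid have "AE z in ?P. ?V t z i \<noteq> ?V t z j \<and> ?V t z i \<noteq> ?V (t - 1) z j"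
      using AE_space
    proof eventually_elim
      case (elim z)
      then have "fst z \<in> space M" by (auto simp: space_pair_measure)
      then show ?case
        using elim ij UE relabelled_positions_distinct[OF elim(2)] by (simp add: case_prod_beta)
    qed
    then show "\<P>(z in ?P. ?V t z i = ?V t z j) = 0" "\<P>(z in ?P. ?V t z i = ?V (t - 1) z j) = 0"
      by (auto intro!: MQ.prob_eq_0_AE elim: AE_mp)
  qed
qed

theorem theorem1:
  fixes N k :: nat
  assumes "N \<ge> 3" and "k \<ge> 1"
    and "\<exists>(M :: 'a measure) U. simple_avoidance_coupling M k (complete_graph_on (N - 1)) U"
  shows "\<exists>(M :: (int \<Rightarrow> nat \<Rightarrow> nat) measure) U. simple_avoidance_coupling M k (complete_graph_on N) U"
proof -
  obtain M :: "'a measure" and U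
    where U: "simple_avoidance_coupling M k (complete_graph_on (N - 1)) U"
    using assms(3) by blast
  have "star_transpositions N \<noteq> {}" using assms(1) by (auto simp: star_transpositions_def)
  then obtain Q :: "((nat \<Rightarrow> nat) \<times> (int \<Rightarrow> nat \<Rightarrow> nat)) measure" and \<sigma>
    where \<sigma>: "simple_random_walk Q (cayley_graph {1..N} (star_transpositions N)) \<sigma>"
    using exists_simple_random_walk_cayley_graph[of "{1..N}" "star_transpositions N"]
      star_transpositions_permutes by blast
  define V where "V = (\<lambda>t (\<omega>, q). \<lambda>i\<in>{1..k}. \<sigma> t q (U t \<omega> i))"
  let ?E = "{1..k} \<rightarrow>\<^sub>E pverts (complete_graph_on N)"
  let ?T = "PiM (UNIV :: int set) (\<lambda>_. count_space ?E)"
  have V: "simple_avoidance_coupling (M \<Otimes>\<^sub>M Q) k (complete_graph_on N) V"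
    unfolding V_def by (rule simple_avoidance_coupling_relabel[OF assms(1) U \<sigma>])
  \<comment> \<open>the law of the trajectories of \<open>V\<close>, with the coordinate maps as the coupling\<close>
  have "simple_avoidance_coupling (distr (M \<Otimes>\<^sub>M Q) ?T (\<lambda>z t. V t z)) k
      (complete_graph_on N) (\<lambda>t x. x t)"
  proof (rule simple_avoidance_coupling_distr)
    have mV: "V t \<in> measurable (M \<Otimes>\<^sub>M Q) (count_space ?E)" for t
      using V by (simp add: simple_avoidance_coupling_def)
    show "(\<lambda>z t. V t z) \<in> measurable (M \<Otimes>\<^sub>M Q) ?T"
      by (intro measurable_PiM_single' mV funcsetI PiE_I) (use measurable_space[OF mV] in simp_all)
    show "finite (pverts (complete_graph_on N))" by (simp add: complete_graph_on_def)
    show "(\<lambda>x. x t) \<in> measurable ?T (count_space ?E)" for t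
      by (rule measurable_component_singleton) simp
  qed (rule V)
  then show ?thesis by blast
qed

end
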